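(* Let $A$, $B$ be nonempty subsets of $\mathbb R$ with $B\subseteq A$, and let $f:A\rightarrow \mathbb R$. Then $f$ is uniformly symmetrically continuous on $A$ with respect to $B$ if and only if for all sequences $(x_n)$ and $(y_n)$ in $A$, if $|x_n-y_n|\rightarrow 0$ as $n\rightarrow \infty$ and $\frac{x_n+y_n}{2}\in B$ for every $n$, then $|f(x_n)-f(y_n)|\rightarrow 0$ as $n\rightarrow \infty$. In particular, $f$ is uniformly symmetrically continuous on $A$ if and only if for all sequences $(x_n)$ and $(y_n)$ in $A$, if $|x_n-y_n|\rightarrow 0$ as $n\rightarrow \infty$ and $\frac{x_n+y_n}{2}\in A$ for every $n$, then $|f(x_n)-f(y_n)|\rightarrow 0$ as $n\rightarrow \infty$.
   Context: Let $A$ be a nonempty subset of $\mathbb R$ and $f:A\to\mathbb R$. The function $f$ is uniformly symmetrically continuous on $A$ if for every $\varepsilon>0$ there exists $\delta>0$ such that $|f(a+h)-f(a-h)|<\varepsilon$ for all $h\in\mathbb R$ and $a\in A$ satisfying $|h|<\delta$, $a+h\in A$ and $a-h\in A$. If $B$ is a nonempty subset of $A$, then $f$ is uniformly symmetrically continuous on $A$ with respect to $B$ if for every $\varepsilon>0$ there exists $\delta>0$ such that $|f(b+h)-f(b-h)|<\varepsilon$ for all $h\in\mathbb R$ and $b\in B$ satisfying $|h|<\delta$, $b+h\in A$ and $b-h\in A$. *)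

theory Defs
  imports Complex_Main
begin

text \<open>A function \<open>f : A \<rightarrow> \<real>\<close> is a total function of which only the values on \<open>A\<close> are used.\<close>

definition unif_symm_continuous_on :: "real set \<Rightarrow> (real \<Rightarrow> real) \<Rightarrow> bool" where
  "unif_symm_continuous_on A f \<longleftrightarrow>
    (\<forall>\<epsilon>>0. \<exists>\<delta>>0. \<forall>h. \<forall>a\<in>A. \<bar>h\<bar> < \<delta> \<longrightarrow> a + h \<in> A \<longrightarrow> a - h \<in> A \<longrightarrow>
      \<bar>f (a + h) - f (a - h)\<bar> < \<epsilon>)"

text \<open>Here \<open>B\<close> is meant to be a nonempty subset of \<open>A\<close>.\<close>

definition unif_symm_continuous_on_wrt :: "real set \<Rightarrow> real set \<Rightarrow> (real \<Rightarrow> real) \<Rightarrow> bool" where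
  "unif_symm_continuous_on_wrt A B f \<longleftrightarrow>
    (\<forall>\<epsilon>>0. \<exists>\<delta>>0. \<forall>h. \<forall>b\<in>B. \<bar>h\<bar> < \<delta> \<longrightarrow> b + h \<in> A \<longrightarrow> b - h \<in> A \<longrightarrow>
      \<bar>f (b + h) - f (b - h)\<bar> < \<epsilon>)"

end

theory Submission
  imports Defs
begin

text \<open>A pair of reals \<open>x\<close>, \<open>y\<close> is the same data as its midpoint
  \<open>b = (x + y) / 2\<close> and half-difference \<open>h = (x - y) / 2\<close>, with
  \<open>x = b + h\<close> and \<open>y = b - h\<close>. Symmetric continuity is thus a uniform
  condition on close pairs in \<open>A\<close> with midpoint in \<open>B\<close>, and the usual
  passage between epsilon-delta and sequences applies. In one direction the \<delta> for a given
  \<epsilon> controls a tail of the sequences; in the other, failure at some \<epsilon> yields a bad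
  pair for each of a null sequence of \<delta>, and these pairs form sequences violating the
  criterion. Continuity on \<open>A\<close> alone is the case \<open>B = A\<close>.\<close>

lemma unif_symm_continuous_on_wrt_iff_sequentially:
  fixes A B :: "real set" and f :: "real \<Rightarrow> real"
  shows "unif_symm_continuous_on_wrt A B f \<longleftrightarrow>
      (\<forall>x y :: nat \<Rightarrow> real. (\<forall>n. x n \<in> A) \<longrightarrow> (\<forall>n. y n \<in> A) \<longrightarrow>
        (\<lambda>n. \<bar>x n - y n\<bar>) \<longlonglongrightarrow> 0 \<longrightarrow> (\<forall>n. (x n + y n) / 2 \<in> B) \<longrightarrow>
        (\<lambda>n. \<bar>f (x n) - f (y n)\<bar>) \<longlonglongrightarrow> 0)"
    (is "_ \<longleftrightarrow> ?seq")
proof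
  assume cont: "unif_symm_continuous_on_wrt A B f"
  show ?seq
  proof (intro allI impI)
    fix x y :: "nat \<Rightarrow> real"
    assume A: "\<forall>n. x n \<in> A" "\<forall>n. y n \<in> A"
      and lim: "(\<lambda>n. \<bar>x n - y n\<bar>) \<longlonglongrightarrow> 0"
      and B: "\<forall>n. (x n + y n) / 2 \<in> B"
    show "(\<lambda>n. \<bar>f (x n) - f (y n)\<bar>) \<longlonglongrightarrow> 0"
    proof (rule LIMSEQ_I)
      fix \<epsilon> :: real assume "\<epsilon> > 0"
      then obtain \<delta> where "\<delta> > 0" and \<delta>: "\<And>h b. b \<in> B \<Longrightarrow> \<bar>h\<bar> < \<delta> \<Longrightarrow> b + h \<in> A \<Longrightarrow> b - h \<in> A
          \<Longrightarrow> \<bar>f (b + h) - f (b - h)\<bar> < \<epsilon>"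
        using cont unfolding unif_symm_continuous_on_wrt_def by metis
      obtain N where N: "\<And>n. n \<ge> N \<Longrightarrow> \<bar>x n - y n\<bar> < \<delta>"
        using LIMSEQ_D[OF lim \<open>\<delta> > 0\<close>] by auto
      have "\<bar>f (x n) - f (y n)\<bar> < \<epsilon>" if "n \<ge> N" for n
      proof -
        have eqs: "(x n + y n) / 2 + (x n - y n) / 2 = x n"
          "(x n + y n) / 2 - (x n - y n) / 2 = y n"
          by (simp_all add: field_simps)
        \<comment> \<open>Halving only shrinks the distance, so asking for \<open>\<delta>\<close>
          rather than \<open>2 * \<delta>\<close> in the choice of \<open>N\<close>
          suffices.\<close>
        have "\<bar>(x n - y n) / 2\<bar> < \<delta>"
          using N[OF that] unfolding abs_divide by simp
        with \<delta>[of "(x n + y n) / 2" "(x n - y n) / 2"] A B show ?thesis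
          unfolding eqs by blast
      qed
      then show "\<exists>N. \<forall>n\<ge>N. norm (\<bar>f (x n) - f (y n)\<bar> - 0) < \<epsilon>"
        by auto
    qed
  qed
next
  assume seq: ?seq
  show "unif_symm_continuous_on_wrt A B f"
  proof (rule ccontr)
    assume "\<not> unif_symm_continuous_on_wrt A B f"
    then obtain \<epsilon> where "\<epsilon> > 0" and "\<forall>\<delta>>0. \<exists>h b. b \<in> B \<and> \<bar>h\<bar> < \<delta> \<and> b + h \<in> A \<and> b - h \<in> A
        \<and> \<bar>f (b + h) - f (b - h)\<bar> \<ge> \<epsilon>"
      unfolding unif_symm_continuous_on_wrt_def by (meson not_less)
    \<comment> \<open>Specialise to \<delta> = 1/(n+1), positive also at \<open>n = 0\<close>;
      choosing a counterexample for each \<open>n\<close> then gives sequences.\<close>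
    then have "\<forall>n. \<exists>h b. b \<in> B \<and> \<bar>h\<bar> < inverse (real (Suc n)) \<and> b + h \<in> A \<and> b - h \<in> A
        \<and> \<bar>f (b + h) - f (b - h)\<bar> \<ge> \<epsilon>"
      by simp
    then obtain h b where hb: "\<And>n. b n \<in> B" "\<And>n. \<bar>h n\<bar> < inverse (real (Suc n))"
        "\<And>n. b n + h n \<in> A" "\<And>n. b n - h n \<in> A"
        and ge: "\<And>n. \<bar>f (b n + h n) - f (b n - h n)\<bar> \<ge> \<epsilon>"
      by metis
    have "h \<longlonglongrightarrow> 0"
      by (rule LIMSEQ_norm_0) (use hb(2) in \<open>simp add: inverse_eq_divide\<close>)
    then have "(\<lambda>n. \<bar>2 * h n\<bar>) \<longlonglongrightarrow> 0"
      by (intro tendsto_rabs_zero tendsto_mult_right_zero)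
    \<comment> \<open>The two sequences differ by \<open>2 * h n\<close>, which tends to 0, and
      their midpoints are the \<open>b n\<close> in \<open>B\<close>.\<close>
    with seq[rule_format, of "\<lambda>n. b n + h n" "\<lambda>n. b n - h n"] hb
    have "(\<lambda>n. \<bar>f (b n + h n) - f (b n - h n)\<bar>) \<longlonglongrightarrow> 0"
      by simp
    \<comment> \<open>Every term is at least \<epsilon>, hence so is the limit 0.\<close>
    then have "\<epsilon> \<le> 0"
      by (rule LIMSEQ_le_const) (use ge in blast)
    with \<open>\<epsilon> > 0\<close> show False
      by simp
  qed
qed

lemma unif_symm_continuous_on_wrt_self:
  "unif_symm_continuous_on_wrt A A f \<longleftrightarrow> unif_symm_continuous_on A f"
  unfolding unif_symm_continuous_on_wrt_def unif_symm_continuous_on_def ..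

theorem theorem2p3:
  fixes A B :: "real set" and f :: "real \<Rightarrow> real"
  assumes "A \<noteq> {}" and "B \<noteq> {}" and "B \<subseteq> A"
  shows "(unif_symm_continuous_on_wrt A B f \<longleftrightarrow>
      (\<forall>x y :: nat \<Rightarrow> real. (\<forall>n. x n \<in> A) \<longrightarrow> (\<forall>n. y n \<in> A) \<longrightarrow>
        (\<lambda>n. \<bar>x n - y n\<bar>) \<longlonglongrightarrow> 0 \<longrightarrow> (\<forall>n. (x n + y n) / 2 \<in> B) \<longrightarrow>
        (\<lambda>n. \<bar>f (x n) - f (y n)\<bar>) \<longlonglongrightarrow> 0)) \<and>
    (unif_symm_continuous_on A f \<longleftrightarrow>
      (\<forall>x y :: nat \<Rightarrow> real. (\<forall>n. x n \<in> A) \<longrightarrow> (\<forall>n. y n \<in> A) \<longrightarrow>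
        (\<lambda>n. \<bar>x n - y n\<bar>) \<longlonglongrightarrow> 0 \<longrightarrow> (\<forall>n. (x n + y n) / 2 \<in> A) \<longrightarrow>
        (\<lambda>n. \<bar>f (x n) - f (y n)\<bar>) \<longlonglongrightarrow> 0))"
  \<comment> \<open>The second equivalence is the first with \<open>A\<close> itself as the set of
    centres.\<close>
  using unif_symm_continuous_on_wrt_iff_sequentially[of A B f]
    unif_symm_continuous_on_wrt_iff_sequentially[of A A f]
  unfolding unif_symm_continuous_on_wrt_self by (rule conjI)

end
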